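(* Let $U:[0,1]^2\to\mathbb{R}$ be a kernel. Then for all integers $m$ and $d$ with $1\leq d\leq m/2$, \[ \sum_{F\in\mathcal{E}_{2d}^+(P_m)} t_F(U) \geq \binom{m}{2d} t_{K_2}(U)^{2d}. \]
   Context: A kernel is a bounded symmetric measurable function $U:[0,1]^2\to\mathbb{R}$. For a graph $F$ and a kernel $U$, $t_F(U):=\int_{[0,1]^{V(F)}}\prod_{ij\in E(F)}U(x_i,x_j)\prod_{i\in V(F)}dx_i$ (Lebesgue measure); in particular $t_{K_2}(U)=\int_{[0,1]^2}U$. $P_m$ denotes the path with $m$ edges (and $m+1$ vertices). $\mathcal{E}_{2d}^+(P_m)$ is the set of subgraphs $F$ of $P_m$ with vertex set $V(F)=V(P_m)$ and exactly $2d$ edges. *)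

theory Defs
  imports "HOL-Analysis.Analysis"
begin

text \<open>A kernel is a function on the unit square. It is represented by a total curried function
  whose values outside \<open>[0,1] \<times> [0,1]\<close> are unconstrained and never used.
  Measurability is Lebesgue measurability.\<close>

definition kernel :: "(real \<Rightarrow> real \<Rightarrow> real) \<Rightarrow> bool" where
  "kernel U \<longleftrightarrow>
     bounded (case_prod U ` ({0..1} \<times> {0..1})) \<and>
     (\<forall>x\<in>{0..1}. \<forall>y\<in>{0..1}. U x y = U y x) \<and>
     case_prod U \<in> borel_measurable (lebesgue_on ({0..1} \<times> {0..1}))"

type_synonym 'v ugraph = "'v set \<times> 'v set set"

abbreviation verts :: "'v ugraph \<Rightarrow> 'v set" where "verts \<equiv> fst"

abbreviation edges :: "'v ugraph \<Rightarrow> 'v set set" where "edges \<equiv> snd"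

definition simple_graph :: "'v ugraph \<Rightarrow> bool" where
  "simple_graph G \<longleftrightarrow> finite (verts G) \<and> (\<forall>e\<in>edges G. e \<subseteq> verts G \<and> card e = 2)"

definition subgraph :: "'v ugraph \<Rightarrow> 'v ugraph \<Rightarrow> bool" where
  "subgraph F G \<longleftrightarrow> simple_graph F \<and> verts F \<subseteq> verts G \<and> edges F \<subseteq> edges G"

definition path_graph :: "nat \<Rightarrow> nat ugraph" where
  "path_graph m = ({0..m}, {{i, i + 1} | i. i < m})"

definition K2 :: "nat ugraph" where
  "K2 = ({0, 1}, {{0, 1}})"

definition spanning_subgraphs :: "nat \<Rightarrow> 'v ugraph \<Rightarrow> 'v ugraph set" where
  "spanning_subgraphs k G = {F. subgraph F G \<and> verts F = verts G \<and> card (edges F) = k}"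

text \<open>Lebesgue measure on the cube \<open>[0,1]^V\<close>. The product measure has to be completed because
  for a kernel \<open>U\<close> that is only Lebesgue measurable, \<open>x \<mapsto> U (x i) (x j)\<close> need not be measurable
  for the product sigma-algebra.\<close>

definition cube_measure :: "'v set \<Rightarrow> ('v \<Rightarrow> real) measure" where
  "cube_measure V = completion (\<Pi>\<^sub>M i\<in>V. lebesgue_on {0..1})"

text \<open>The linear order on the vertices only serves to list the two endpoints of an edge
  \<open>e = {i, j}\<close>; for a kernel, which is symmetric, the order of the endpoints is irrelevant.\<close>

definition hom_density :: "'v::linorder ugraph \<Rightarrow> (real \<Rightarrow> real \<Rightarrow> real) \<Rightarrow> real" where
  "hom_density F U =
     (LINT x|cube_measure (verts F). (\<Prod>e\<in>edges F. U (x (Min e)) (x (Max e))))"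

end

theory Submission
  imports Defs "HOL-Probability.Infinite_Product_Measure"
begin

text \<open>Let \<open>t\<^sub>k\<close> be the density of the path with \<open>k\<close> edges and \<open>T = \<Sum>k. t\<^sub>k X\<^sup>k\<close>. Cutting
  \<open>P\<^sub>m\<close> at the missing edges shows that the sum over \<open>F\<close> is the coefficient of \<open>X\<^sup>2\<^sup>d\<close> in
  \<open>T\<^sup>n\<^sup>+\<^sup>1\<close>, where \<open>n = m - 2 d\<close>. If \<open>\<mu>\<close> is the spectral measure of the integral operator at
  the constant function 1, this coefficient is the expectation of the complete homogeneous
  symmetric polynomial \<open>h\<close> of degree \<open>2 d\<close> in \<open>n + 1\<close> independent \<open>\<mu>\<close>-distributed variables
  \<open>\<lambda>\<^sub>i\<close>. Since \<open>(2d)! h(\<lambda>)\<close> is the expectation of \<open>(\<Sum>i. \<xi>\<^sub>i \<lambda>\<^sub>i)\<^sup>2\<^sup>d\<close> for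
  independent standard exponential \<open>\<xi>\<^sub>i\<close>, the polynomial \<open>h\<close> is convex, and Jensen's
  inequality gives the bound. No spectral theorem is needed: moment sequences are replaced by
  sequences whose Hankel form is positive semidefinite, a class that is closed under binomial
  convolution (the sum of independent variables) with the moment sequence of the operator.\<close>

unbundle no vec_syntax and fps_syntax

section \<open>Hankel-positive sequences\<close>

text \<open>If \<open>w\<close> were the moment sequence of a random variable \<open>X\<close>, this
  form would be the expectation of the square of the polynomial in \<open>X\<close> with
  coefficients \<open>p\<close>.\<close>

definition hankel_psd :: "(nat \<Rightarrow> real) \<Rightarrow> bool" where
  "hankel_psd w \<longleftrightarrow> (\<forall>N p. 0 \<le> (\<Sum>i\<le>N. \<Sum>j\<le>N. p i * p j * w (i + j)))"

text \<open>Collecting the coefficients \<open>r\<close> by the value of \<open>g\<close> gives a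
  polynomial, so families with repeated exponents reduce to the defining form.\<close>

lemma hankel_psd_sum_nonneg:
  fixes r :: "'k \<Rightarrow> real" and g :: "'k \<Rightarrow> nat"
  assumes w: "hankel_psd w" and K: "finite K"
  shows "0 \<le> (\<Sum>k\<in>K. \<Sum>l\<in>K. r k * r l * w (g k + g l))"
proof -
  obtain N where N: "\<And>k. k \<in> K \<Longrightarrow> g k \<le> N"
    using K by (metis Max_ge finite_imageI imageI)
  define p where "p i = sum r {k\<in>K. g k = i}" for i
  have grp: "(\<Sum>k\<in>K. r k * h (g k)) = (\<Sum>i\<le>N. p i * h i)" for h :: "nat \<Rightarrow> real"
  proof -
    have "(\<Sum>k\<in>K. r k * h (g k)) = (\<Sum>i\<le>N. \<Sum>k\<in>{k\<in>K. g k = i}. r k * h (g k))"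
      using K N by (intro sum.group[symmetric]) auto
    then show ?thesis
      by (simp add: p_def sum_distrib_right)
  qed
  have inner: "(\<Sum>l\<in>K. r l * w (g k + g l)) = (\<Sum>j\<le>N. p j * w (g k + j))" for k
    by (rule grp[of "\<lambda>j. w (g k + j)"])
  have "(\<Sum>k\<in>K. \<Sum>l\<in>K. r k * r l * w (g k + g l)) =
      (\<Sum>k\<in>K. r k * (\<Sum>l\<in>K. r l * w (g k + g l)))"
    by (simp add: sum_distrib_left mult.assoc)
  also have "\<dots> = (\<Sum>i\<le>N. p i * (\<Sum>j\<le>N. p j * w (i + j)))"
    unfolding inner by (rule grp[of "\<lambda>i. \<Sum>j\<le>N. p j * w (i + j)"])
  also have "\<dots> = (\<Sum>i\<le>N. \<Sum>j\<le>N. p i * p j * w (i + j))"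
    by (simp add: sum_distrib_left mult.assoc)
  also have "0 \<le> \<dots>"
    using w unfolding hankel_psd_def by blast
  finally show ?thesis .
qed

lemma hankel_psd_even_nonneg:
  assumes "hankel_psd w"
  shows "0 \<le> w (2 * k)"
  using hankel_psd_sum_nonneg[OF assms, of "{k}" "\<lambda>_. 1" id] by (simp add: mult_2)

lemma hankel_psd_cauchy_schwarz:
  assumes "hankel_psd w"
  shows "(w (a + b))\<^sup>2 \<le> w (2 * a) * w (2 * b)"
proof (cases "a = b")
  case True
  then show ?thesis by (simp add: power2_eq_square mult_2)
next
  case False
  \<comment> \<open>The form for the polynomial \<open>x X^a + y X^b\<close>.\<close>
  have q: "0 \<le> x\<^sup>2 * w (2 * a) + 2 * x * y * w (a + b) + y\<^sup>2 * w (2 * b)" for x y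
  proof -
    have "0 \<le> (x * x * w (a + a) + x * y * w (a + b)) + (y * x * w (b + a) + y * y * w (b + b))"
      using hankel_psd_sum_nonneg[OF assms, of "{a, b}" "\<lambda>k. if k = a then x else y" id] False
      by simp
    also have "\<dots> = x\<^sup>2 * w (2 * a) + 2 * x * y * w (a + b) + y\<^sup>2 * w (2 * b)"
      unfolding mult_2[of a] mult_2[of b] add.commute[of b a] power2_eq_square by algebra
    finally show ?thesis .
  qed
  let ?A = "w (2 * a)" and ?B = "w (a + b)" and ?C = "w (2 * b)"
  have A: "0 \<le> ?A" and C: "0 \<le> ?C"
    using hankel_psd_even_nonneg[OF assms] by auto
  show ?thesis
  proof (cases "?C = 0")
    case True
    have "?B = 0"
    proof (rule ccontr)
      assume "?B \<noteq> 0"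
      \<comment> \<open>With \<open>w (2 * b) = 0\<close> the form is affine in \<open>y\<close>;
        the chosen \<open>y\<close> gives it the value -1.\<close>
      then show False
        using q[of 1 "- (?A + 1) / (2 * ?B)"] True A by (simp add: field_simps)
    qed
    then show ?thesis using A C by simp
  next
    case False
    then have "0 < ?C" using C by simp
    \<comment> \<open>Up to scaling, these arguments minimise the form.\<close>
    have "0 \<le> ?C * (?A * ?C - ?B\<^sup>2)"
      using q[of ?C "- ?B"] by (simp add: algebra_simps power2_eq_square)
    then show ?thesis
      using \<open>0 < ?C\<close> by (simp add: zero_le_mult_iff)
  qed
qed

text \<open>Jensen's inequality for the power \<open>2 * d\<close>: by Cauchy-Schwarz the even
  moments are log-convex, so their successive ratios are at least the first one, and
  \<open>(w 1)^2 <= w 2\<close>.\<close>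

lemma hankel_psd_moment_le:
  assumes w: "hankel_psd w" and w0: "w 0 = 1"
  shows "w 1 ^ (2 * d) \<le> w (2 * d)"
proof -
  define v where "v k = w (2 * k)" for k
  have v_nonneg: "0 \<le> v k" for k
    using hankel_psd_even_nonneg[OF w] by (simp add: v_def)
  \<comment> \<open>Stated without division, since an even moment may vanish.\<close>
  have step: "v k * v 1 \<le> v (Suc k)" for k
  proof (induction k)
    case 0
    then show ?case by (simp add: v_def w0)
  next
    case (Suc k)
    have cs: "(v (Suc k))\<^sup>2 \<le> v k * v (Suc (Suc k))"
      using hankel_psd_cauchy_schwarz[OF w, of k "Suc (Suc k)"] by (simp add: v_def mult_2)
    show ?case
    proof (cases "v k = 0")
      case True
      then have "v (Suc k) = 0" using cs by simp
      then show ?thesis using v_nonneg by simp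
    next
      case False
      then have pos: "0 < v k" using v_nonneg[of k] by simp
      have "v k * (v (Suc k) * v 1) \<le> v (Suc k) * v (Suc k)"
        using mult_right_mono[OF Suc v_nonneg[of "Suc k"]] by (simp add: ac_simps)
      also have "\<dots> \<le> v k * v (Suc (Suc k))"
        using cs by (simp add: power2_eq_square)
      finally show ?thesis using pos by simp
    qed
  qed
  have "v 1 ^ d \<le> v d"
  proof (induction d)
    case 0
    then show ?case by (simp add: v_def w0)
  next
    case (Suc d)
    have "v 1 ^ Suc d \<le> v d * v 1"
      using mult_right_mono[OF Suc v_nonneg[of 1]] by (simp add: mult.commute)
    then show ?case using step[of d] by linarith
  qed
  moreover have "(w 1)\<^sup>2 \<le> v 1"
    using hankel_psd_cauchy_schwarz[OF w, of 0 1] by (simp add: v_def w0)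
  then have "((w 1)\<^sup>2) ^ d \<le> v 1 ^ d"
    by (intro power_mono) auto
  ultimately show ?thesis
    by (simp add: v_def power_mult)
qed

text \<open>The expansion of \<open>(X + Y)^n\<close> with each monomial \<open>X^a Y^b\<close>
  replaced by \<open>G a b\<close>. For \<open>G a b = s a * w b\<close> it is the binomial
  convolution.\<close>

definition binomial_sum :: "nat \<Rightarrow> (nat \<Rightarrow> nat \<Rightarrow> real) \<Rightarrow> real" where
  "binomial_sum n G = (\<Sum>k\<le>n. real (n choose k) * G k (n - k))"

lemma binomial_sum_Suc:
  "binomial_sum (Suc n) G =
     binomial_sum n (\<lambda>a b. G (Suc a) b) + binomial_sum n (\<lambda>a b. G a (Suc b))"
proof -
  have "binomial_sum (Suc n) G =
      G 0 (Suc n) + (\<Sum>k\<le>n. real (Suc n choose Suc k) * G (Suc k) (n - k))"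
    by (simp add: binomial_sum_def sum.atMost_Suc_shift del: sum.atMost_Suc binomial_Suc_Suc)
  also have "\<dots> = binomial_sum n (\<lambda>a b. G (Suc a) b) +
      (G 0 (Suc n) + (\<Sum>k\<le>n. real (n choose Suc k) * G (Suc k) (n - k)))"
    by (simp add: binomial_sum_def algebra_simps sum.distrib)
  also have "G 0 (Suc n) + (\<Sum>k\<le>n. real (n choose Suc k) * G (Suc k) (n - k)) =
      (\<Sum>k\<le>Suc n. real (n choose k) * G k (Suc n - k))"
    by (simp add: sum.atMost_Suc_shift del: sum.atMost_Suc)
  also have "\<dots> = binomial_sum n (\<lambda>a b. G a (Suc b))"
    by (simp add: binomial_sum_def Suc_diff_le)
  finally show ?thesis .
qed

lemma binomial_sum_add:
  "binomial_sum n (\<lambda>a b. G a b + H a b) = binomial_sum n G + binomial_sum n H"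
  by (simp add: binomial_sum_def algebra_simps sum.distrib)

text \<open>Splits \<open>(X + Y)^(i + j)\<close> into two powers. The induction shifts the
  arguments of \<open>G\<close>, so \<open>G\<close> has to be arbitrary rather than a
  product.\<close>

lemma binomial_sum_plus:
  "binomial_sum (i + j) G =
     binomial_sum i (\<lambda>a b. binomial_sum j (\<lambda>a' b'. G (a + a') (b + b')))"
proof (induction i arbitrary: G)
  case 0
  then show ?case by (simp add: binomial_sum_def[of 0])
next
  case (Suc i)
  show ?case
    by (simp add: binomial_sum_Suc Suc.IH binomial_sum_add)
qed

text \<open>For fixed \<open>x\<close>, substituting \<open>f a x\<close> for \<open>X^a\<close> in
  the sum of the \<open>p i (X + Y)^i\<close> leaves a polynomial in \<open>Y\<close>, on which the
  form of \<open>w\<close> is nonnegative. Integrating over \<open>x\<close> turns products of the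
  \<open>f\<close> into \<open>s\<close> and yields the form of the convolution.\<close>

lemma hankel_psd_binomial_conv:
  fixes f :: "nat \<Rightarrow> 'a \<Rightarrow> real"
  assumes w: "hankel_psd w"
    and int: "\<And>i j. integrable M (\<lambda>x. f i x * f j x)"
    and s: "\<And>i j. s (i + j) = (LINT x|M. f i x * f j x)"
  shows "hankel_psd (\<lambda>n. binomial_sum n (\<lambda>a b. s a * w b))"
  unfolding hankel_psd_def
proof (intro allI)
  fix N :: nat and p :: "nat \<Rightarrow> real"
  \<comment> \<open>An index \<open>(i, a)\<close> stands for the monomial
    \<open>X^a Y^(i - a)\<close>: \<open>r\<close> is its coefficient after the substitution,
    \<open>g\<close> the exponent of \<open>Y\<close>.\<close>
  define K where "K = (SIGMA i:{..N}. {..i})"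
  define r where "r x = (\<lambda>(i, a). p i * real (i choose a) * f a x)" for x
  define g :: "nat \<times> nat \<Rightarrow> nat" where "g = (\<lambda>(i, a). i - a)"
  define h where "h i a j b =
      p i * p j * (real (i choose a) * (real (j choose b) * (s (a + b) * w (i - a + (j - b)))))"
    for i a j b
  have r_eq: "r x k * r x l * c =
      (p (fst k) * real (fst k choose snd k) * p (fst l) * real (fst l choose snd l) * c) *
        (f (snd k) x * f (snd l) x)" for x k l c
    by (simp add: r_def case_prod_beta')
  have sum_K: "(\<Sum>k\<in>K. q (fst k) (snd k)) = (\<Sum>i\<le>N. \<Sum>a\<le>i. q i a)" for q :: "nat \<Rightarrow> nat \<Rightarrow> real"
    unfolding K_def by (simp add: sum.Sigma case_prod_beta')
  have K: "finite K" by (simp add: K_def)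
  have "0 \<le> (LINT x|M. (\<Sum>k\<in>K. \<Sum>l\<in>K. r x k * r x l * w (g k + g l)))"
    by (intro integral_nonneg_AE AE_I2 hankel_psd_sum_nonneg[OF w K])
  also have "\<dots> = (\<Sum>k\<in>K. \<Sum>l\<in>K. LINT x|M. r x k * r x l * w (g k + g l))"
  proof -
    have int': "integrable M (\<lambda>x. r x k * r x l * w (g k + g l))" for k l
      using int unfolding r_eq by simp
    have "(LINT x|M. (\<Sum>k\<in>K. \<Sum>l\<in>K. r x k * r x l * w (g k + g l))) =
        (\<Sum>k\<in>K. LINT x|M. (\<Sum>l\<in>K. r x k * r x l * w (g k + g l)))"
      by (intro Bochner_Integration.integral_sum Bochner_Integration.integrable_sum int')
    also have "\<dots> = (\<Sum>k\<in>K. \<Sum>l\<in>K. LINT x|M. r x k * r x l * w (g k + g l))"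
      by (intro sum.cong refl Bochner_Integration.integral_sum int')
    finally show ?thesis .
  qed
  also have "\<dots> = (\<Sum>k\<in>K. \<Sum>l\<in>K. h (fst k) (snd k) (fst l) (snd l))"
    unfolding r_eq by (simp add: s[symmetric]) (simp add: h_def g_def case_prod_beta' mult_ac)
  also have "\<dots> = (\<Sum>i\<le>N. \<Sum>a\<le>i. \<Sum>j\<le>N. \<Sum>b\<le>j. h i a j b)"
    unfolding sum_K by (rule sum_K)
  also have "\<dots> = (\<Sum>i\<le>N. \<Sum>j\<le>N. \<Sum>a\<le>i. \<Sum>b\<le>j. h i a j b)"
    by (rule sum.cong[OF refl]) (rule sum.swap)
  also have "\<dots> = (\<Sum>i\<le>N. \<Sum>j\<le>N. p i * p j * binomial_sum (i + j) (\<lambda>a b. s a * w b))"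
  proof (intro sum.cong refl)
    fix i j
    have "(\<Sum>a\<le>i. \<Sum>b\<le>j. h i a j b) = p i * p j *
        binomial_sum i (\<lambda>a b. binomial_sum j (\<lambda>a' b'. s (a + a') * w (b + b')))"
      unfolding h_def binomial_sum_def sum_distrib_left ..
    also have "\<dots> = p i * p j * binomial_sum (i + j) (\<lambda>a b. s a * w b)"
      unfolding binomial_sum_plus ..
    finally show "(\<Sum>a\<le>i. \<Sum>b\<le>j. h i a j b) =
        p i * p j * binomial_sum (i + j) (\<lambda>a b. s a * w b)" .
  qed
  finally show "0 \<le> (\<Sum>i\<le>N. \<Sum>j\<le>N. p i * p j * binomial_sum (i + j) (\<lambda>a b. s a * w b))" .
qed

section \<open>Powers of a moment series\<close>

lemma fact_fps_mult_nth:
  fixes F G :: "real fps"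
  shows "fact n * (F * G) $ n = binomial_sum n (\<lambda>a b. (fact a * F $ a) * (fact b * G $ b))"
  unfolding binomial_sum_def fps_mult_nth sum_distrib_left atLeast0AtMost
proof (rule sum.cong[OF refl])
  fix k assume "k \<in> {..n}"
  then have "(fact n :: real) = fact k * fact (n - k) * real (n choose k)"
    by (metis atMost_iff binomial_fact_lemma of_nat_fact of_nat_mult)
  then show "fact n * (F $ k * G $ (n - k)) =
      real (n choose k) * (fact k * F $ k * (fact (n - k) * G $ (n - k)))"
    by simp
qed

lemma has_integral_power_exp:
  "((\<lambda>x::real. x ^ k / exp x) has_integral fact k) {0..}"
proof -
  have "((\<lambda>x::real. x powr (real (Suc k) - 1) / exp x) has_integral Gamma (real (Suc k))) {0..}"
    by (rule Gamma_integral_real) simp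
  then have "((\<lambda>x::real. x powr real k / exp x) has_integral fact k) {0..}"
    by (simp add: Gamma_fact[symmetric])
  \<comment> \<open>At 0 with \<open>k = 0\<close>, \<open>powr\<close> gives 0 but \<open>^\<close>
    gives 1.\<close>
  then show ?thesis
    by (rule has_integral_spike[of "{0}", rotated 2]) (auto simp: powr_realpow)
qed

text \<open>Averaging over a standard exponential \<open>x\<close> replaces \<open>x ^ k\<close> by
  \<open>fact k\<close>, which cancels the denominators.\<close>

lemma has_integral_exp_mult_nth:
  fixes F G :: "real fps"
  shows "((\<lambda>x. (Abs_fps (\<lambda>k. x ^ k * F $ k / fact k) * G) $ n / exp x)
           has_integral (F * G) $ n) {0..}"
proof -
  have "((\<lambda>x::real. \<Sum>k=0..n. (F $ k / fact k * G $ (n - k)) * (x ^ k / exp x))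
      has_integral (\<Sum>k=0..n. (F $ k / fact k * G $ (n - k)) * fact k)) {0..}"
    by (intro has_integral_sum has_integral_mult_right has_integral_power_exp) auto
  then show ?thesis
    unfolding fps_mult_nth sum_divide_distrib by (simp add: ac_simps)
qed

text \<open>The negative binomial series; the induction step is the hockey-stick identity.\<close>

lemma fps_geometric_power_nth:
  "(Abs_fps (\<lambda>k. c ^ k) ^ Suc n :: real fps) $ k = real ((n + k) choose k) * c ^ k"
proof (induction n arbitrary: k)
  case 0
  then show ?case by simp
next
  case (Suc n)
  have "(Abs_fps (\<lambda>k. c ^ k) ^ Suc (Suc n)) $ k =
      (Abs_fps (\<lambda>k. c ^ k) ^ Suc n * Abs_fps (\<lambda>k. c ^ k)) $ k"
    by (simp only: power_Suc2)
  also have "\<dots> = (\<Sum>i\<le>k. real ((n + i) choose i) * c ^ k)"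
    unfolding fps_mult_nth atLeast0AtMost Suc.IH
    by (intro sum.cong refl) (simp add: power_add[symmetric])
  also have "\<dots> = real (\<Sum>i\<le>k. (n + i) choose i) * c ^ k"
    by (simp add: sum_distrib_right)
  finally show ?case
    by (simp only: sum_choose_lower add_Suc)
qed

text \<open>\<open>W\<close> is the exponential generating function of the factors already randomised; the
  induction step draws the scale \<open>x\<close> of the next factor from the exponential distribution and
  applies the induction hypothesis for fixed \<open>x\<close>.\<close>

lemma fps_power_mult_nth_ge:
  fixes f :: "nat \<Rightarrow> 'a \<Rightarrow> real" and T W :: "real fps"
  assumes int: "\<And>i j. integrable M (\<lambda>x. f i x * f j x)"
    and T: "\<And>i j. T $ (i + j) = (LINT x|M. f i x * f j x)"
    and T0: "T $ 0 = 1"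
    and W: "hankel_psd (\<lambda>k. fact k * W $ k)" and W0: "W $ 0 = 1"
  shows "(fps_exp (W $ 1) * Abs_fps (\<lambda>k. (T $ 1) ^ k) ^ j) $ (2 * d) \<le> (W * T ^ j) $ (2 * d)"
  using W W0
proof (induction j arbitrary: W)
  \<comment> \<open>The left coefficient is \<open>(W $ 1)^(2 * d) / fact (2 * d)\<close>, so
    Jensen's inequality for the sequence of \<open>W\<close> suffices.\<close>
  case 0
  then show ?case
    using hankel_psd_moment_le[OF 0(1), of d] by (simp add: divide_le_eq mult.commute)
next
  case (Suc j)
  define c where "c = T $ 1"
  define G where "G = Abs_fps (\<lambda>k. c ^ k)"
  define T' where "T' x = Abs_fps (\<lambda>k. x ^ k * T $ k / fact k)" for x
  \<comment> \<open>\<open>T' x * W\<close> encodes the old sum plus an independent variable scaled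
    by \<open>x\<close>. Its mean is \<open>x * c + W $ 1\<close>, so the exponential on the left
    splits.\<close>
  have le: "(fps_exp (x * c) * (fps_exp (W $ 1) * G ^ j)) $ (2 * d) \<le> (T' x * (W * T ^ j)) $ (2 * d)"
    for x
  proof -
    have "hankel_psd (\<lambda>n. binomial_sum n (\<lambda>a b. (x ^ a * T $ a) * (fact b * W $ b)))"
    proof (rule hankel_psd_binomial_conv[OF Suc.prems(1)])
      fix i k
      have eq: "(\<lambda>y. x ^ i * f i y * (x ^ k * f k y)) = (\<lambda>y. x ^ (i + k) * (f i y * f k y))"
        by (auto simp: power_add)
      show "integrable M (\<lambda>y. x ^ i * f i y * (x ^ k * f k y))"
        unfolding eq using int by simp
      show "x ^ (i + k) * T $ (i + k) = (LINT y|M. x ^ i * f i y * (x ^ k * f k y))"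
        unfolding eq by (simp add: T)
    qed
    then have psd: "hankel_psd (\<lambda>k. fact k * (T' x * W) $ k)"
      by (simp add: fact_fps_mult_nth T'_def)
    have 0: "(T' x * W) $ 0 = 1"
      by (simp add: T'_def T0 Suc.prems)
    have 1: "(T' x * W) $ 1 = x * c + W $ 1"
      by (simp add: fps_mult_nth T'_def T0 Suc.prems c_def)
    show ?thesis
      using Suc.IH[OF psd 0] unfolding 1 c_def[symmetric] G_def[symmetric]
      by (simp add: fps_exp_add_mult mult.assoc)
  qed
  \<comment> \<open>The exponential is the geometric series with factorials inserted, so averaging
    over \<open>x\<close> restores \<open>G\<close> on the left just as it restores \<open>T\<close>
    on the right.\<close>
  have exp_eq: "fps_exp (x * c) = Abs_fps (\<lambda>k. x ^ k * G $ k / fact k)" for x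
    by (rule fps_ext) (simp add: G_def power_mult_distrib)
  have "(G * (fps_exp (W $ 1) * G ^ j)) $ (2 * d) \<le> (T * (W * T ^ j)) $ (2 * d)"
  proof (rule has_integral_le)
    show "((\<lambda>x. (fps_exp (x * c) * (fps_exp (W $ 1) * G ^ j)) $ (2 * d) / exp x)
        has_integral (G * (fps_exp (W $ 1) * G ^ j)) $ (2 * d)) {0..}"
      unfolding exp_eq by (rule has_integral_exp_mult_nth)
    show "((\<lambda>x. (T' x * (W * T ^ j)) $ (2 * d) / exp x)
        has_integral (T * (W * T ^ j)) $ (2 * d)) {0..}"
      unfolding T'_def by (rule has_integral_exp_mult_nth)
  qed (use le in \<open>simp add: divide_right_mono\<close>)
  then show ?case
    unfolding G_def c_def by (simp add: ac_simps)
qed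

lemma fps_power_nth_ge:
  fixes f :: "nat \<Rightarrow> 'a \<Rightarrow> real" and T :: "real fps"
  assumes int: "\<And>i j. integrable M (\<lambda>x. f i x * f j x)"
    and T: "\<And>i j. T $ (i + j) = (LINT x|M. f i x * f j x)"
    and T0: "T $ 0 = 1"
  shows "real ((n + 2 * d) choose (2 * d)) * (T $ 1) ^ (2 * d) \<le> (T ^ Suc n) $ (2 * d)"
proof -
  \<comment> \<open>The starting series 1 encodes a variable that is constantly 0; its form is
    \<open>(p 0)^2\<close>.\<close>
  have "hankel_psd (\<lambda>k. fact k * (1 :: real fps) $ k)"
    unfolding hankel_psd_def
  proof (intro allI)
    fix N and p :: "nat \<Rightarrow> real"
    have "p i * p j * (fact (i + j) * (1 :: real fps) $ (i + j)) =
        (if j = 0 then if i = 0 then p 0 * p 0 else 0 else 0)" for i j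
      by simp
    then show "0 \<le> (\<Sum>i\<le>N. \<Sum>j\<le>N. p i * p j * (fact (i + j) * (1 :: real fps) $ (i + j)))"
      by (simp only: sum.delta finite_atMost) simp
  qed
  from fps_power_mult_nth_ge[OF int T T0 this, of "Suc n" d]
  show ?thesis
    by (simp add: fps_geometric_power_nth del: power_Suc)
qed

section \<open>Subgraphs of a path\<close>

lemma subsets_lessThan_Suc:
  fixes m :: nat
  shows
  "{S. S \<subseteq> {..<Suc m} \<and> card S = Suc k} =
     {S. S \<subseteq> {..<m} \<and> card S = Suc k} \<union> insert m ` {S. S \<subseteq> {..<m} \<and> card S = k}"
  (is "?L = ?R1 \<union> ?R2")
proof (intro equalityI subsetI)
  fix S assume S: "S \<in> ?L"
  then have fin: "finite S" using finite_subset[of S "{..<Suc m}"] by simp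
  show "S \<in> ?R1 \<union> ?R2"
  proof (cases "m \<in> S")
    case True
    then have "S = insert m (S - {m})" "S - {m} \<in> {S. S \<subseteq> {..<m} \<and> card S = k}"
      using S fin by (auto simp: less_Suc_eq)
    then show ?thesis by blast
  next
    case False
    then show ?thesis using S by (auto simp: less_Suc_eq)
  qed
next
  fix S assume "S \<in> ?R1 \<union> ?R2"
  then consider "S \<in> ?R1" | R where "S = insert m R" "R \<subseteq> {..<m}" "card R = k"
    by auto
  then show "S \<in> ?L"
  proof cases
    case 1
    then show ?thesis by (auto simp: less_Suc_eq)
  next
    case 2
    have "finite R" "m \<notin> R" using 2(2) finite_subset[OF 2(2)] by auto
    with 2 show ?thesis by (simp add: lessThan_Suc subset_insertI2 insert_mono)
  qed
qed

section \<open>The integral operator of a bounded symmetric kernel\<close>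

locale kernel_space = prob_space M for M :: "'a measure" +
  fixes V :: "'a \<Rightarrow> 'a \<Rightarrow> real" and B :: real
  assumes V_measurable: "case_prod V \<in> borel_measurable (M \<Otimes>\<^sub>M M)"
    and V_bound: "\<bar>V x y\<bar> \<le> B"
    and V_sym: "V x y = V y x"
begin

definition kernel_op :: "('a \<Rightarrow> real) \<Rightarrow> 'a \<Rightarrow> real" where
  "kernel_op h x = (LINT y|M. V x y * h y)"

definition bounded_measurable :: "('a \<Rightarrow> real) \<Rightarrow> bool" where
  "bounded_measurable h \<longleftrightarrow> h \<in> borel_measurable M \<and> (\<exists>C. \<forall>x. \<bar>h x\<bar> \<le> C)"

sublocale MM: pair_prob_space M M ..

sublocale PM: product_prob_space "\<lambda>_ :: nat. M" I for I
  by unfold_locales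

lemma B_nonneg: "0 \<le> B"
  using V_bound[of undefined undefined] abs_ge_zero order_trans by blast

lemma bounded_measurable_measurable: "bounded_measurable h \<Longrightarrow> h \<in> borel_measurable M"
  by (simp add: bounded_measurable_def)

lemma bounded_measurable_const [simp]: "bounded_measurable (\<lambda>_. c)"
  by (auto simp: bounded_measurable_def)

lemma bounded_measurable_integrable_mult: "bounded_measurable g \<Longrightarrow> bounded_measurable h \<Longrightarrow> integrable M (\<lambda>x. g x * h x)"
proof -
  assume g: "bounded_measurable g" and h: "bounded_measurable h"
  obtain C D where "\<And>x. \<bar>g x\<bar> \<le> C" "\<And>x. \<bar>h x\<bar> \<le> D"
    using g h by (auto simp: bounded_measurable_def)
  then have "\<bar>g x * h x\<bar> \<le> C * D" for x
    unfolding abs_mult by (intro mult_mono) (auto intro: order_trans[OF abs_ge_zero])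
  moreover note bounded_measurable_measurable[OF g, measurable] bounded_measurable_measurable[OF h, measurable]
  ultimately show ?thesis
    by (intro integrable_const_bound[where B = "C * D"]) auto
qed

lemma bounded_measurable_kernel_op:
  assumes h: "bounded_measurable h"
  shows "bounded_measurable (kernel_op h)"
proof -
  note bounded_measurable_measurable[OF h, measurable] V_measurable[measurable]
  obtain C where C: "\<And>x. \<bar>h x\<bar> \<le> C"
    using h by (auto simp: bounded_measurable_def)
  have le: "\<bar>V x y * h y\<bar> \<le> B * C" for x y
    unfolding abs_mult using V_bound C B_nonneg by (intro mult_mono) auto
  then have BC: "0 \<le> B * C"
    using abs_ge_zero order_trans by blast
  have "\<bar>kernel_op h x\<bar> \<le> B * C" for x
  proof (cases "integrable M (\<lambda>y. V x y * h y)")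
    case True
    have "\<bar>kernel_op h x\<bar> \<le> (LINT y|M. \<bar>V x y * h y\<bar>)"
      unfolding kernel_op_def by (rule integral_abs_bound)
    also have "\<dots> \<le> (LINT y|M. B * C)"
      using True le by (intro integral_mono) auto
    finally show ?thesis by (simp add: prob_space)
  next
    \<comment> \<open>The integral is 0 by default here.\<close>
    case False
    then show ?thesis using BC by (simp add: kernel_op_def not_integrable_integral_eq)
  qed
  moreover have "kernel_op h \<in> borel_measurable M"
    unfolding kernel_op_def by measurable
  ultimately show ?thesis
    by (auto simp: bounded_measurable_def)
qed

text \<open>Fubini's theorem together with the symmetry of \<open>V\<close>.\<close>

lemma kernel_op_selfadjoint:
  assumes g: "bounded_measurable g" and h: "bounded_measurable h"
  shows "(LINT x|M. kernel_op g x * h x) = (LINT x|M. g x * kernel_op h x)"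
proof -
  note bounded_measurable_measurable[OF g, measurable] bounded_measurable_measurable[OF h, measurable] V_measurable[measurable]
  obtain C D where "\<And>x. \<bar>g x\<bar> \<le> C" "\<And>x. \<bar>h x\<bar> \<le> D"
    using g h by (auto simp: bounded_measurable_def)
  then have "\<bar>g x * V x y * h y\<bar> \<le> C * B * D" for x y
    unfolding abs_mult using V_bound B_nonneg
    by (intro mult_mono) (auto intro: order_trans[OF abs_ge_zero] mult_nonneg_nonneg)
  then have "integrable (M \<Otimes>\<^sub>M M) (\<lambda>(x, y). g x * V x y * h y)"
    by (intro MM.P.integrable_const_bound[where B = "C * B * D"]) auto
  from MM.Fubini_integral[OF this]
  have "(LINT y|M. LINT x|M. g x * V x y * h y) = (LINT x|M. LINT y|M. g x * V x y * h y)" .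
  moreover have "(LINT x|M. g x * V x y) = kernel_op g y" for y
    by (simp add: kernel_op_def V_sym[of y] mult.commute)
  moreover have "(LINT y|M. g x * V x y * h y) = g x * kernel_op h x" for x
    by (simp add: kernel_op_def mult.assoc)
  ultimately show ?thesis by simp
qed

text \<open>\<open>walk j x\<close> is the total weight of walks with \<open>j\<close> edges
  starting at \<open>x\<close>.\<close>

definition walk :: "nat \<Rightarrow> 'a \<Rightarrow> real" where
  "walk j = (kernel_op ^^ j) (\<lambda>_. 1)"

definition path_series :: "real fps" where
  "path_series = Abs_fps (\<lambda>k. LINT x|M. walk k x)"

lemma walk_0 [simp]: "walk 0 = (\<lambda>_. 1)"
  by (simp add: walk_def)

lemma walk_Suc: "walk (Suc j) = kernel_op (walk j)"
  by (simp add: walk_def)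

lemma bounded_measurable_walk: "bounded_measurable (walk j)"
  by (induction j) (simp_all add: walk_Suc bounded_measurable_kernel_op)

lemma path_series_0: "path_series $ 0 = 1"
  by (simp add: path_series_def prob_space)

text \<open>Self-adjointness moves the operator across the product one step at a time. This
  representation of the path densities stands in for the spectral measure.\<close>

lemma path_series_add: "path_series $ (i + j) = (LINT x|M. walk i x * walk j x)"
proof (induction i arbitrary: j)
  case 0
  then show ?case by (simp add: path_series_def)
next
  case (Suc i)
  have "path_series $ (Suc i + j) = (LINT x|M. walk i x * walk (Suc j) x)"
    using Suc[of "Suc j"] by simp
  also have "\<dots> = (LINT x|M. walk (Suc i) x * walk j x)"
    unfolding walk_Suc by (rule kernel_op_selfadjoint[symmetric]) (rule bounded_measurable_walk)+
  finally show ?case .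
qed

text \<open>\<open>S\<close> holds the left endpoints of the edges present. The weight
  \<open>h\<close> on the last vertex lets a recursion on \<open>m\<close> remove that
  vertex.\<close>

definition path_integral :: "nat \<Rightarrow> nat set \<Rightarrow> ('a \<Rightarrow> real) \<Rightarrow> real" where
  "path_integral m S h =
     (LINT x|Pi\<^sub>M {0..m} (\<lambda>_. M). (\<Prod>i\<in>S. V (x i) (x (i + 1))) * h (x m))"

lemma edge_measurable:
  assumes "i \<in> I" "j \<in> I"
  shows "(\<lambda>x. V (x i) (x j)) \<in> borel_measurable (Pi\<^sub>M I (\<lambda>_. M))"
proof -
  have "(\<lambda>x. case_prod V (x i, x j)) \<in> borel_measurable (Pi\<^sub>M I (\<lambda>_. M))"
    using assms
    by (intro measurable_compose[OF _ V_measurable] measurable_Pair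
        measurable_component_singleton)
  then show ?thesis by simp
qed

lemma edges_measurable:
  fixes m :: nat
  assumes "S \<subseteq> {..<m}"
  shows "(\<lambda>x. \<Prod>i\<in>S. V (x i) (x (i + 1))) \<in> borel_measurable (Pi\<^sub>M {0..m} (\<lambda>_. M))"
  using assms by (intro borel_measurable_prod edge_measurable) (auto simp: subset_iff Suc_le_eq)

lemma path_integral_integrable:
  fixes m :: nat
  assumes S: "S \<subseteq> {..<m}" and h: "bounded_measurable h"
  shows "integrable (Pi\<^sub>M {0..m} (\<lambda>_. M)) (\<lambda>x. (\<Prod>i\<in>S. V (x i) (x (i + 1))) * h (x m))"
proof -
  note bounded_measurable_measurable[OF h, measurable] edges_measurable[OF S, measurable]
  obtain C where C: "\<And>x. \<bar>h x\<bar> \<le> C"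
    using h by (auto simp: bounded_measurable_def)
  have le: "\<bar>(\<Prod>i\<in>S. V (x i) (x (i + 1))) * h (x m)\<bar> \<le> (\<Prod>i\<in>S. B) * C" for x
    unfolding abs_mult abs_prod using V_bound B_nonneg C
    by (intro mult_mono prod_mono) (auto simp: prod_nonneg)
  have fin: "finite_measure (Pi\<^sub>M {0..m} (\<lambda>_. M))"
    by (intro prob_space.finite_measure prob_space_PiM) (rule prob_space_axioms)
  show ?thesis
  proof (rule finite_measure.integrable_const_bound[OF fin])
    show "AE x in Pi\<^sub>M {0..m} (\<lambda>_. M). norm ((\<Prod>i\<in>S. V (x i) (x (i + 1))) * h (x m)) \<le> (\<Prod>i\<in>S. B) * C"
      using le by auto
  qed measurable
qed

lemma path_integral_0: "bounded_measurable h \<Longrightarrow> path_integral 0 {} h = (LINT x|M. h x)"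
  unfolding path_integral_def
  using PM.product_integral_singleton[of h 0] by (simp add: bounded_measurable_measurable)

lemma path_integral_const: "path_integral m S (\<lambda>_. c) = c * path_integral m S (\<lambda>_. 1)"
  by (simp add: path_integral_def mult.commute)

text \<open>The last vertex is isolated, so its integral factors out.\<close>

lemma path_integral_skip:
  assumes S: "S \<subseteq> {..<m}" and h: "bounded_measurable h"
  shows "path_integral (Suc m) S h = (LINT y|M. h y) * path_integral m S (\<lambda>_. 1)"
proof -
  have S': "S \<subseteq> {..<Suc m}" using S by auto
  have ins: "{0..Suc m} = insert (Suc m) {0..m}" by auto
  have "path_integral (Suc m) S h = (LINT x|Pi\<^sub>M {0..m} (\<lambda>_. M). LINT y|M.
      (\<Prod>i\<in>S. V ((x(Suc m := y)) i) ((x(Suc m := y)) (i + 1))) * h ((x(Suc m := y)) (Suc m)))"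
    unfolding path_integral_def ins
    by (rule PM.product_integral_insert[OF _ _ path_integral_integrable[OF S' h, unfolded ins]]) auto
  also have "\<dots> = (LINT x|Pi\<^sub>M {0..m} (\<lambda>_. M). LINT y|M.
      (\<Prod>i\<in>S. V (x i) (x (i + 1))) * h y)"
  proof -
    have "(\<Prod>i\<in>S. V ((x(Suc m := y)) i) ((x(Suc m := y)) (i + 1))) =
        (\<Prod>i\<in>S. V (x i) (x (i + 1)))" for x :: "nat \<Rightarrow> 'a" and y
      using S by (intro prod.cong) auto
    then show ?thesis by (simp only: fun_upd_same)
  qed
  also have "\<dots> = path_integral m S (\<lambda>_. LINT y|M. h y)"
    by (simp add: path_integral_def)
  also have "\<dots> = (LINT y|M. h y) * path_integral m S (\<lambda>_. 1)"
    by (rule path_integral_const)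
  finally show ?thesis .
qed

text \<open>The last vertex is joined only to \<open>m\<close>; integrating it out moves the weight
  to \<open>m\<close> as \<open>kernel_op h\<close>.\<close>

lemma path_integral_insert:
  assumes S: "S \<subseteq> {..<m}" and h: "bounded_measurable h"
  shows "path_integral (Suc m) (insert m S) h = path_integral m S (kernel_op h)"
proof -
  have S': "insert m S \<subseteq> {..<Suc m}" using S by auto
  have fin: "finite S" and m: "m \<notin> S" using S finite_subset[of S "{..<m}"] by auto
  have ins: "{0..Suc m} = insert (Suc m) {0..m}" by auto
  have "path_integral (Suc m) (insert m S) h = (LINT x|Pi\<^sub>M {0..m} (\<lambda>_. M). LINT y|M.
      (\<Prod>i\<in>insert m S. V ((x(Suc m := y)) i) ((x(Suc m := y)) (i + 1))) *
        h ((x(Suc m := y)) (Suc m)))"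
    unfolding path_integral_def ins
    by (rule PM.product_integral_insert[OF _ _ path_integral_integrable[OF S' h, unfolded ins]]) auto
  also have "\<dots> = (LINT x|Pi\<^sub>M {0..m} (\<lambda>_. M). LINT y|M.
      (\<Prod>i\<in>S. V (x i) (x (i + 1))) * (V (x m) y * h y))"
  proof -
    have "(\<Prod>i\<in>S. V ((x(Suc m := y)) i) ((x(Suc m := y)) (i + 1))) =
        (\<Prod>i\<in>S. V (x i) (x (i + 1)))" for x :: "nat \<Rightarrow> 'a" and y
      using S by (intro prod.cong) auto
    then show ?thesis
      by (simp only: fun_upd_same prod.insert[OF fin m]) (simp add: mult_ac)
  qed
  also have "\<dots> = path_integral m S (kernel_op h)"
    by (simp add: path_integral_def kernel_op_def)
  finally show ?thesis .
qed

text \<open>The \<open>m - k\<close> missing edges cut off \<open>m - k\<close> components, each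
  contributing a factor \<open>path_series\<close>, before the last one. That one has
  \<open>j\<close> edges and carries \<open>h\<close>, whence the integral of
  \<open>walk j x * h x\<close>.\<close>

lemma sum_path_integral:
  assumes "bounded_measurable h"
  shows "(\<Sum>S | S \<subseteq> {..<m} \<and> card S = k. path_integral m S h) =
    (if k \<le> m then \<Sum>j\<le>k. (path_series ^ (m - k)) $ (k - j) * (LINT x|M. walk j x * h x) else 0)"
  using assms
proof (induction m arbitrary: k h)
  case 0
  have "{S. S \<subseteq> {..<0::nat} \<and> card S = k} = (if k = 0 then {{}} else {})"
    by auto
  then show ?case using 0 by (simp add: path_integral_0)
next
  case (Suc m)
  note h = Suc.prems
  show ?case
  proof (cases k)
    case 0
    have e: "{S. S \<subseteq> {..<n} \<and> card S = 0} = {{}}" for n :: nat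
      by (auto dest: finite_subset[OF _ finite_lessThan])
    have "path_integral m {} (\<lambda>_. 1) = 1"
      using Suc.IH[of "\<lambda>_. 1" 0] unfolding e
      by (simp add: prob_space fps_power_zeroth path_series_0)
    then show ?thesis
      unfolding 0 e
      by (simp add: path_integral_skip h fps_power_zeroth path_series_0 del: power_Suc)
  next
    case (Suc l)
    let ?X = "\<lambda>k. {S. S \<subseteq> {..<m} \<and> card S = k}"
    let ?T = "path_series"
    have fin: "finite (?X k)" for k
      by (rule finite_subset[of _ "Pow {..<m}"]) auto
    have inj: "inj_on (insert m) (?X l)"
      by (rule inj_onI)
        (metis (no_types, lifting) insert_ident lessThan_iff less_irrefl mem_Collect_eq subsetD)
    have "(\<Sum>S | S \<subseteq> {..<Suc m} \<and> card S = Suc l. path_integral (Suc m) S h) =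
        (\<Sum>S\<in>?X (Suc l). path_integral (Suc m) S h) +
        (\<Sum>S\<in>insert m ` ?X l. path_integral (Suc m) S h)"
      unfolding subsets_lessThan_Suc by (rule sum.union_disjoint) (use fin in auto)
    also have "(\<Sum>S\<in>?X (Suc l). path_integral (Suc m) S h) =
        (LINT x|M. h x) * (\<Sum>S\<in>?X (Suc l). path_integral m S (\<lambda>_. 1))"
      by (simp add: sum_distrib_left path_integral_skip h)
    also have "(\<Sum>S\<in>insert m ` ?X l. path_integral (Suc m) S h) =
        (\<Sum>S\<in>?X l. path_integral m S (kernel_op h))"
      by (subst sum.reindex[OF inj]) (simp add: path_integral_insert h)
    also have "\<dots> =
        (if l \<le> m then \<Sum>j\<le>l. (?T ^ (m - l)) $ (l - j) * (LINT x|M. walk (Suc j) x * h x) else 0)"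
      unfolding Suc.IH[OF bounded_measurable_kernel_op[OF h]] walk_Suc
        kernel_op_selfadjoint[OF bounded_measurable_walk h] ..
    also have "(\<Sum>S\<in>?X (Suc l). path_integral m S (\<lambda>_. 1)) =
        (if Suc l \<le> m then (?T ^ (m - l)) $ Suc l else 0)"
    proof (cases "Suc l \<le> m")
      case True
      \<comment> \<open>With weight 1 the last component is an ordinary path, and the sum over
        \<open>j\<close> is a Cauchy product with one more factor.\<close>
      have "(\<Sum>S\<in>?X (Suc l). path_integral m S (\<lambda>_. 1)) =
          (\<Sum>j\<le>Suc l. ?T $ j * (?T ^ (m - Suc l)) $ (Suc l - j))"
        using True
        by (subst Suc.IH) (simp_all add: path_series_def mult.commute del: sum.atMost_Suc)
      also have "\<dots> = (?T * ?T ^ (m - Suc l)) $ Suc l"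
        by (simp add: fps_mult_nth atLeast0AtMost)
      also have "?T * ?T ^ (m - Suc l) = ?T ^ (m - l)"
        using True by (metis Suc_diff_Suc Suc_le_eq power_Suc)
      finally show ?thesis using True by simp
    next
      case False
      then show ?thesis by (subst Suc.IH) simp_all
    qed
    finally have eq: "(\<Sum>S | S \<subseteq> {..<Suc m} \<and> card S = Suc l. path_integral (Suc m) S h) =
      (LINT x|M. h x) * (if Suc l \<le> m then (?T ^ (m - l)) $ Suc l else 0) +
      (if l \<le> m then \<Sum>j\<le>l. (?T ^ (m - l)) $ (l - j) * (LINT x|M. walk (Suc j) x * h x) else 0)" .
    \<comment> \<open>In \<open>eq\<close> the first summand is the term \<open>j = 0\<close> of the
      goal and the second gives the terms \<open>j >= 1\<close>. For \<open>l = m\<close> every edge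
      is present and the term \<open>j = 0\<close> vanishes.\<close>
    consider "Suc l \<le> m" | "l = m" | "m < l" by linarith
    then show ?thesis
    proof cases
      case 1
      then show ?thesis
        unfolding Suc eq by (simp add: sum.atMost_Suc_shift del: sum.atMost_Suc)
    next
      case 2
      then show ?thesis
        unfolding Suc eq by (simp add: sum.atMost_Suc_shift del: sum.atMost_Suc)
    next
      case 3
      then show ?thesis
        unfolding Suc eq by simp
    qed
  qed
qed

lemma sum_path_integral_1:
  assumes "k \<le> m"
  shows "(\<Sum>S | S \<subseteq> {..<m} \<and> card S = k. path_integral m S (\<lambda>_. 1)) =
    (path_series ^ Suc (m - k)) $ k"
  using assms
  by (subst sum_path_integral) (simp_all add: fps_mult_nth atLeast0AtMost path_series_def mult.commute)

end

section \<open>Kernels on the unit square\<close>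

text \<open>Integrating out coordinate \<open>i\<close> first gives 0, because for almost every
  value of coordinate \<open>j\<close> the section of the exceptional set is null.\<close>

lemma (in prob_space) AE_PiM_pair:
  assumes ae: "AE p in M \<Otimes>\<^sub>M M. P p" and I: "finite I" "i \<in> I" "j \<in> I" "i \<noteq> j"
  shows "AE x in Pi\<^sub>M I (\<lambda>_. M). P (x i, x j)"
proof -
  interpret MM: pair_prob_space M M ..
  interpret PM: product_prob_space "\<lambda>_. M" J for J :: "'b set"
    by unfold_locales
  obtain N where N: "{p \<in> space (M \<Otimes>\<^sub>M M). \<not> P p} \<subseteq> N" "emeasure (M \<Otimes>\<^sub>M M) N = 0"
    "N \<in> sets (M \<Otimes>\<^sub>M M)"
    by (rule AE_E[OF ae])
  let ?J = "I - {i}"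
  have ins: "insert i ?J = I" using I by auto
  have ij: "i \<in> insert i ?J" "j \<in> insert i ?J" using I by auto
  have pair: "(\<lambda>x. (x i, x j)) \<in> Pi\<^sub>M (insert i ?J) (\<lambda>_. M) \<rightarrow>\<^sub>M M \<Otimes>\<^sub>M M"
    using ij by (intro measurable_Pair measurable_component_singleton)
  have meas: "(\<lambda>x. indicator N (x i, x j) :: ennreal) \<in> borel_measurable (Pi\<^sub>M (insert i ?J) (\<lambda>_. M))"
    by (rule measurable_compose[OF pair borel_measurable_indicator[OF N(3)]])
  have "AE p in M \<Otimes>\<^sub>M M. p \<notin> N"
    using N by (intro AE_not_in null_setsI)
  \<comment> \<open>The swap puts the second coordinate outermost, so that sections are taken at a
    fixed \<open>x j\<close>.\<close>
  then have "AE p in distr (M \<Otimes>\<^sub>M M) (M \<Otimes>\<^sub>M M) (\<lambda>(x, y). (y, x)). p \<notin> N"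
    unfolding MM.distr_pair_swap[symmetric] .
  from MM.AE_pair[OF AE_distrD[OF measurable_pair_swap' this]] have "AE b in M. AE a in M. (a, b) \<notin> N"
    by simp
  then have "AE b in M. (\<integral>\<^sup>+a. indicator N (a, b) \<partial>M) = 0"
  proof eventually_elim
    case (elim b)
    then have "(\<integral>\<^sup>+a. indicator N (a, b) \<partial>M) = (\<integral>\<^sup>+a. 0 \<partial>M)"
      by (intro nn_integral_cong_AE) (auto elim!: eventually_mono)
    then show ?case by simp
  qed
  then have "AE x in Pi\<^sub>M ?J (\<lambda>_. M). (\<integral>\<^sup>+a. indicator N (a, x j) \<partial>M) = 0"
    by (rule PM.AE_component[rotated]) (use I in simp)
  then have "(\<integral>\<^sup>+x. \<integral>\<^sup>+a. indicator N (a, x j) \<partial>M \<partial>Pi\<^sub>M ?J (\<lambda>_. M)) =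
      (\<integral>\<^sup>+x. 0 \<partial>Pi\<^sub>M ?J (\<lambda>_. M))"
    by (rule nn_integral_cong_AE)
  moreover have "(\<integral>\<^sup>+x. indicator N (x i, x j) \<partial>Pi\<^sub>M (insert i ?J) (\<lambda>_. M)) =
      (\<integral>\<^sup>+x. \<integral>\<^sup>+a. indicator N ((x(i := a)) i, (x(i := a)) j) \<partial>M \<partial>Pi\<^sub>M ?J (\<lambda>_. M))"
    by (rule PM.product_nn_integral_insert) (use I(1) meas in simp_all)
  ultimately have "(\<integral>\<^sup>+x. indicator N (x i, x j) \<partial>Pi\<^sub>M I (\<lambda>_. M)) = 0"
    using I(4) unfolding ins by simp
  then have "AE x in Pi\<^sub>M I (\<lambda>_. M). indicator N (x i, x j) = (0 :: ennreal)"
    using meas unfolding ins by (simp add: nn_integral_0_iff_AE)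
  moreover have "AE x in Pi\<^sub>M I (\<lambda>_. M). (x i, x j) \<in> space (M \<Otimes>\<^sub>M M)"
    by (rule AE_I2) (rule measurable_space[OF pair[unfolded ins]])
  ultimately show ?thesis
  proof eventually_elim
    case (elim x)
    then show ?case
      using subsetD[OF N(1), of "(x i, x j)"] by (cases "P (x i, x j)") simp_all
  qed
qed

text \<open>Preimages under \<open>f\<close> and \<open>g\<close> differ by null sets, so
  \<open>f\<close> is measurable for the completion even if not for \<open>M\<close>.\<close>

lemma integral_completion_cong_AE:
  fixes f g :: "'a \<Rightarrow> real"
  assumes g: "g \<in> borel_measurable M" and ae: "AE x in M. f x = g x"
  shows "(LINT x|completion M. f x) = (LINT x|M. g x)"
proof -
  have g': "g \<in> borel_measurable (completion M)"
    using g by (rule measurable_completion)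
  have ae': "AE x in completion M. f x = g x"
    using ae by (rule AE_completion)
  have f': "f \<in> borel_measurable (completion M)"
  proof (rule measurableI)
    fix A :: "real set" assume A: "A \<in> sets borel"
    show "f -` A \<inter> space (completion M) \<in> sets (completion M)"
    proof (rule completion.in_sets_AE)
      show "AE x in completion M. (x \<in> g -` A \<inter> space (completion M)) =
          (x \<in> f -` A \<inter> space (completion M))"
        using ae' by eventually_elim auto
    qed (use measurable_sets[OF g' A] in auto)
  qed simp
  show ?thesis
    using integral_cong_AE[OF f' g' ae'] integral_completion[OF g] by simp
qed

lemma prob_space_unit_interval: "prob_space (lebesgue_on {0..1::real})"
  by (intro prob_space_restrict_space) auto

text \<open>Fubini splits the statement into sections, which restrict to the interval and are then
  reassembled. Reassembly needs the exceptional set measurable for the product, hence the Borel null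
  set \<open>N\<close>.\<close>

lemma AE_lborel_pair_imp_unit_square:
  fixes P :: "real \<times> real \<Rightarrow> bool"
  assumes "AE p in lborel. P p"
  shows "AE p in lebesgue_on {0..1} \<Otimes>\<^sub>M lebesgue_on {0..1}. P p"
proof -
  let ?M = "lebesgue_on {0..1::real}"
  interpret prob_space ?M by (rule prob_space_unit_interval)
  interpret MM: pair_prob_space ?M ?M ..
  obtain N where N: "{p \<in> space lborel. \<not> P p} \<subseteq> N" "emeasure lborel N = 0" "N \<in> sets lborel"
    by (rule AE_E[OF assms])
  have "AE p in lborel \<Otimes>\<^sub>M lborel. p \<notin> N"
    unfolding lborel_prod using N by (intro AE_not_in null_setsI)
  from lborel_pair.AE_pair[OF this]
  have *: "AE x in lborel. AE y in lborel. (x, y) \<notin> N" .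
  have restr: "AE x in ?M. Q x" if "AE x in lborel. Q x" for Q
    using AE_completion[OF that] by (subst AE_restrict_space_iff) auto
  have id[measurable]: "(\<lambda>x. x) \<in> ?M \<rightarrow>\<^sub>M borel"
    using measurable_completion[of "\<lambda>x :: real. x" lborel borel]
    by (intro measurable_restrict_space1) auto
  have "(\<lambda>p. (fst p, snd p)) \<in> ?M \<Otimes>\<^sub>M ?M \<rightarrow>\<^sub>M borel \<Otimes>\<^sub>M borel"
    by (intro measurable_Pair measurable_compose[OF measurable_fst id]
        measurable_compose[OF measurable_snd id])
  then have m: "(\<lambda>p. p) \<in> ?M \<Otimes>\<^sub>M ?M \<rightarrow>\<^sub>M borel"
    by (simp add: borel_prod)
  have "AE x in ?M. AE y in ?M. (x, y) \<notin> N"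
  proof (rule restr)
    show "AE x in lborel. AE y in ?M. (x, y) \<notin> N"
      using * by eventually_elim (rule restr)
  qed
  moreover have "{p \<in> space (?M \<Otimes>\<^sub>M ?M). p \<notin> N} \<in> sets (?M \<Otimes>\<^sub>M ?M)"
  proof -
    have "N \<in> sets borel" using N(3) by simp
    from measurable_sets[OF m borel_comp[OF this]]
    moreover have "{p \<in> space (?M \<Otimes>\<^sub>M ?M). p \<notin> N} =
        (\<lambda>p. p) -` (- N) \<inter> space (?M \<Otimes>\<^sub>M ?M)"
      by auto
    ultimately show ?thesis by (simp only:)
  qed
  ultimately have "AE p in ?M \<Otimes>\<^sub>M ?M. p \<notin> N"
    by (intro MM.AE_pair_measure)
  moreover have "P p" if "p \<notin> N" for p
    using N(1) that by auto
  ultimately show ?thesis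
    by (rule eventually_mono)
qed

text \<open>Averaging over the coordinate swap makes the Borel representative symmetric everywhere.\<close>

lemma kernel_borel_representative:
  assumes U: "kernel U"
  obtains V B where "kernel_space (lebesgue_on {0..1}) V B"
    "AE p in lebesgue_on {0..1} \<Otimes>\<^sub>M lebesgue_on {0..1}. case_prod U p = case_prod V p"
proof -
  let ?M = "lebesgue_on {0..1::real}" and ?S = "{0..1::real} \<times> {0..1::real}"
  obtain B where B: "\<And>p. p \<in> ?S \<Longrightarrow> \<bar>case_prod U p\<bar> \<le> B"
    using U unfolding kernel_def bounded_iff by auto
  have S: "?S \<in> sets lebesgue"
    by (intro lmeasurable_cbox[THEN fmeasurableD] | simp add: closed_Times borel_closed)+
  have "(\<lambda>p. indicator ?S p *\<^sub>R case_prod U p) \<in> borel_measurable lebesgue"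
    using U S unfolding kernel_def by (subst (asm) borel_measurable_restrict_space_iff) auto
  then obtain g where g: "g \<in> borel_measurable lborel"
    and ae: "AE p in lborel. indicator ?S p *\<^sub>R case_prod U p = g p"
    using completion_ex_borel_measurable_real by blast
  define V0 where "V0 p = max (- B) (min B (g p))" for p
  define V where "V x y = (V0 (x, y) + V0 (y, x)) / 2" for x y
  have B0: "0 \<le> B"
    using B[of "(0, 0)"] by auto
  have V0_bound: "\<bar>V0 p\<bar> \<le> B" for p
    using B0 by (auto simp: V0_def)
  have V0_eq: "AE p in lborel. p \<in> ?S \<longrightarrow> V0 p = case_prod U p"
    using ae
  proof eventually_elim
    case (elim p)
    then show ?case using B[of p] by (auto simp: V0_def indicator_def)
  qed
  have swap: "distr (lborel \<Otimes>\<^sub>M lborel) (lborel \<Otimes>\<^sub>M lborel) (\<lambda>(x, y). (y, x)) =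
      (lborel :: (real \<times> real) measure)"
    using lborel_pair.distr_pair_swap lborel_prod by metis
  have V0_eq': "AE p in lborel. prod.swap p \<in> ?S \<longrightarrow> V0 (prod.swap p) = case_prod U (prod.swap p)"
  proof -
    have "AE p in distr (lborel \<Otimes>\<^sub>M lborel) (lborel \<Otimes>\<^sub>M lborel) (\<lambda>(x, y). (y, x)).
        p \<in> ?S \<longrightarrow> V0 p = case_prod U p"
      unfolding swap by (rule V0_eq)
    from AE_distrD[OF measurable_pair_swap' this]
    show ?thesis unfolding lborel_prod by (simp add: prod.swap_def case_prod_beta')
  qed
  have "AE p in lborel. p \<in> ?S \<longrightarrow> case_prod U p = case_prod V p"
    using V0_eq V0_eq'
  proof eventually_elim
    case (elim p)
    moreover obtain x y where "p = (x, y)" by (cases p)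
    moreover have "U x y = U y x" if "x \<in> {0..1}" "y \<in> {0..1}"
      using U that by (auto simp: kernel_def)
    ultimately show ?case by (auto simp: V_def)
  qed
  then have eq: "AE p in ?M \<Otimes>\<^sub>M ?M. p \<in> ?S \<longrightarrow> case_prod U p = case_prod V p"
    by (rule AE_lborel_pair_imp_unit_square)
  have "AE p in ?M \<Otimes>\<^sub>M ?M. p \<in> ?S"
    by (rule AE_I2) (auto simp: space_pair_measure)
  with eq have eq': "AE p in ?M \<Otimes>\<^sub>M ?M. case_prod U p = case_prod V p"
    by eventually_elim auto
  have id: "(\<lambda>x. x) \<in> ?M \<rightarrow>\<^sub>M borel"
    using measurable_completion[of "\<lambda>x :: real. x" lborel borel]
    by (intro measurable_restrict_space1) auto
  have V0: "V0 \<in> borel_measurable borel"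
    using g unfolding V0_def by measurable
  have fs: "(\<lambda>p. (fst p, snd p)) \<in> ?M \<Otimes>\<^sub>M ?M \<rightarrow>\<^sub>M borel"
    "(\<lambda>p. (snd p, fst p)) \<in> ?M \<Otimes>\<^sub>M ?M \<rightarrow>\<^sub>M borel"
    unfolding borel_prod[symmetric]
    by (intro measurable_Pair measurable_compose[OF measurable_fst id]
        measurable_compose[OF measurable_snd id])+
  have "case_prod V = (\<lambda>p. (V0 (fst p, snd p) + V0 (snd p, fst p)) / 2)"
    by (auto simp: V_def)
  also have "\<dots> \<in> borel_measurable (?M \<Otimes>\<^sub>M ?M)"
    by (intro borel_measurable_divide borel_measurable_add measurable_const
        measurable_compose[OF fs(1) V0] measurable_compose[OF fs(2) V0]) (simp only: space_borel UNIV_I)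
  finally have V_meas: "case_prod V \<in> borel_measurable (?M \<Otimes>\<^sub>M ?M)" .
  have "kernel_space ?M V B"
  proof (intro kernel_space.intro kernel_space_axioms.intro)
    show "\<bar>V x y\<bar> \<le> B" for x y
      using V0_bound[of "(x, y)"] V0_bound[of "(y, x)"] by (auto simp: V_def)
    show "V x y = V y x" for x y
      by (simp add: V_def add.commute)
  qed (rule prob_space_unit_interval V_meas)+
  then show thesis
    using eq' by (rule that)
qed

section \<open>Spanning subgraphs of the path and the final inequality\<close>

lemma inj_path_edge: "inj (\<lambda>i :: nat. {i, i + 1})"
  by (rule injI) (auto simp: doubleton_eq_iff)

lemma spanning_subgraphs_path:
  "spanning_subgraphs k (path_graph m) =
     (\<lambda>S. ({0..m}, (\<lambda>i. {i, i + 1}) ` S)) ` {S. S \<subseteq> {..<m} \<and> card S = k}"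
proof (intro equalityI subsetI)
  fix F assume "F \<in> spanning_subgraphs k (path_graph m)"
  then obtain E where F: "F = ({0..m}, E)" and E: "E \<subseteq> (\<lambda>i. {i, i + 1}) ` {..<m}" "card E = k"
    by (cases F) (auto simp: spanning_subgraphs_def subgraph_def path_graph_def)
  obtain S where S: "S \<subseteq> {..<m}" "E = (\<lambda>i. {i, i + 1}) ` S"
    using E(1) by (meson subset_imageE)
  moreover have "card S = k"
    using E(2) unfolding S(2) by (subst (asm) card_image[OF inj_on_subset[OF inj_path_edge]]) auto
  ultimately show "F \<in> (\<lambda>S. ({0..m}, (\<lambda>i. {i, i + 1}) ` S)) ` {S. S \<subseteq> {..<m} \<and> card S = k}"
    using F by auto
next
  fix F assume "F \<in> (\<lambda>S. ({0..m}, (\<lambda>i. {i, i + 1}) ` S)) ` {S. S \<subseteq> {..<m} \<and> card S = k}"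
  then obtain S where S: "S \<subseteq> {..<m}" "card S = k" "F = ({0..m}, (\<lambda>i. {i, i + 1}) ` S)"
    by auto
  have "card ((\<lambda>i. {i, i + 1}) ` S) = k"
    using S(2) by (subst card_image[OF inj_on_subset[OF inj_path_edge]]) auto
  then show "F \<in> spanning_subgraphs k (path_graph m)"
    using S(1) unfolding S(3)
    by (fastforce simp: spanning_subgraphs_def subgraph_def path_graph_def simple_graph_def)
qed

text \<open>\<open>Min\<close> and \<open>Max\<close> of an edge are its left and right endpoints.
  Each edge factor may be changed from \<open>U\<close> to \<open>V\<close> almost everywhere, since
  its endpoints are distinct coordinates.\<close>

lemma hom_density_path_edges:
  assumes V: "kernel_space (lebesgue_on {0..1}) V B"
    and ae: "AE p in lebesgue_on {0..1} \<Otimes>\<^sub>M lebesgue_on {0..1}. case_prod U p = case_prod V p"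
    and S: "S \<subseteq> {..<m}"
  shows "hom_density ({0..m}, (\<lambda>i. {i, i + 1}) ` S) U =
    kernel_space.path_integral (lebesgue_on {0..1}) V m S (\<lambda>_. 1)"
proof -
  let ?M = "lebesgue_on {0..1::real}"
  interpret kernel_space ?M V B by (rule V)
  have fin: "finite S" using S finite_subset[OF S] by simp
  have "(\<Prod>e\<in>(\<lambda>i. {i, i + 1}) ` S. U (x (Min e)) (x (Max e))) =
      (\<Prod>i\<in>S. U (x i) (x (i + 1)))" for x :: "nat \<Rightarrow> real"
    by (subst prod.reindex[OF inj_on_subset[OF inj_path_edge]]) auto
  then have "hom_density ({0..m}, (\<lambda>i. {i, i + 1}) ` S) U =
      (LINT x|completion (Pi\<^sub>M {0..m} (\<lambda>_. ?M)). (\<Prod>i\<in>S. U (x i) (x (i + 1))))"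
    by (simp add: hom_density_def cube_measure_def)
  also have "\<dots> = (LINT x|Pi\<^sub>M {0..m} (\<lambda>_. ?M). (\<Prod>i\<in>S. V (x i) (x (i + 1))))"
  proof (rule integral_completion_cong_AE[OF edges_measurable[OF S]])
    have "AE x in Pi\<^sub>M {0..m} (\<lambda>_. ?M). \<forall>i\<in>S. U (x i) (x (i + 1)) = V (x i) (x (i + 1))"
    proof (rule AE_finite_allI[OF fin])
      fix i assume "i \<in> S"
      then have "i < m" using S by auto
      then show "AE x in Pi\<^sub>M {0..m} (\<lambda>_. ?M). U (x i) (x (i + 1)) = V (x i) (x (i + 1))"
        using AE_PiM_pair[OF ae, of "{0..m}" i "i + 1"] by simp
    qed
    then show "AE x in Pi\<^sub>M {0..m} (\<lambda>_. ?M).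
        (\<Prod>i\<in>S. U (x i) (x (i + 1))) = (\<Prod>i\<in>S. V (x i) (x (i + 1)))"
      by eventually_elim (auto intro: prod.cong)
  qed
  finally show ?thesis by (simp add: path_integral_def)
qed

theorem theorem2p2:
  fixes U :: "real \<Rightarrow> real \<Rightarrow> real" and m d :: nat
  assumes "kernel U" and "1 \<le> d" and "real d \<le> real m / 2"
  shows "(\<Sum>F\<in>spanning_subgraphs (2 * d) (path_graph m). hom_density F U)
           \<ge> real (m choose (2 * d)) * hom_density K2 U ^ (2 * d)"
proof -
  let ?M = "lebesgue_on {0..1::real}"
  obtain V B where V: "kernel_space ?M V B"
    and ae: "AE p in ?M \<Otimes>\<^sub>M ?M. case_prod U p = case_prod V p"
    using kernel_borel_representative[OF assms(1)] .
  interpret kernel_space ?M V B by (rule V)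
  have m: "2 * d \<le> m" using assms(3) by linarith
  let ?X = "{S. S \<subseteq> {..<m} \<and> card S = 2 * d}"
  have inj: "inj_on (\<lambda>S. ({0..m}, (\<lambda>i. {i, i + 1}) ` S)) ?X"
    by (rule inj_onI) (use inj_path_edge in \<open>auto simp: inj_image_eq_iff\<close>)
  have sum: "(\<Sum>F\<in>spanning_subgraphs (2 * d) (path_graph m). hom_density F U) =
      (path_series ^ Suc (m - 2 * d)) $ (2 * d)"
    unfolding spanning_subgraphs_path sum.reindex[OF inj]
    unfolding sum_path_integral_1[OF m, symmetric] o_def
    by (rule sum.cong[OF refl]) (rule hom_density_path_edges[OF V ae], simp)
  have e: "{S. S \<subseteq> {..<1::nat} \<and> card S = 1} = {{0}}"
    by (auto simp: card_1_singleton_iff)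
  \<comment> \<open>\<open>K2\<close> is the path with one edge, so its density is the case
    \<open>m = k = 1\<close> of the same formula.\<close>
  have "K2 = ({0..1}, (\<lambda>i. {i, i + 1}) ` {0})"
    by (auto simp: K2_def)
  then have "hom_density K2 U = path_integral 1 {0} (\<lambda>_. 1)"
    using hom_density_path_edges[OF V ae, of "{0}" 1] by simp
  also have "\<dots> = path_series $ 1"
    using sum_path_integral_1[of 1 1] unfolding e by simp
  finally have K2: "hom_density K2 U = path_series $ 1" .
  show ?thesis
    unfolding sum K2
    using fps_power_nth_ge[OF bounded_measurable_integrable_mult[OF bounded_measurable_walk bounded_measurable_walk]
        path_series_add path_series_0, of "m - 2 * d" d] m
    by simp
qed

end
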